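(* Let $p$ be a prime number. Equip the compact additive group $\mathbb{Z}_p[[\Gamma]]^{\mathrm{aug}=0}$ with its Haar probability measure, and for $h \in \mathbb{Z}_p[[\Gamma]]^{\mathrm{aug}=0}$ put $\lambda(h) := 2\lambda_S(\Phi(h)) - 1$ and $\mu(h) := \mu_S(\Phi(h))$. Then $\mu(h) = 0$ for almost every $h$, and for every integer $\lambda' \geq 1$ the probability that $\lambda(h) = 2\lambda' - 1$ is $$\frac{1}{p^{\lambda'-1}}\left(1 - \frac{1}{p}\right).$$
   Context: $\Gamma$ is a profinite group, written multiplicatively, isomorphic to $\mathbb{Z}_p$, with a fixed topological generator $\gamma$. $\mathbb{Z}_p[[\Gamma]] = \varprojlim_n \mathbb{Z}_p[\Gamma/\Gamma^{p^n}]$ is identified with $\mathbb{Z}_p[[T]]$ by $\gamma \leftrightarrow 1+T$. $\mathrm{aug}:\mathbb{Z}_p[[\Gamma]] \to \mathbb{Z}_p$ is the augmentation map ($T \mapsto 0$), and $\mathbb{Z}_p[[\Gamma]]^{\mathrm{aug}=0} = \{h \in \mathbb{Z}_p[[\Gamma]] \mid \mathrm{aug}(h)=0\} \simeq T\mathbb{Z}_p[[T]]$, a compact additive group. $\iota$ is the involution of the $\mathbb{Z}_p$-algebra $\mathbb{Z}_p[[T]]$ given by $\iota(f)(T) = f((1+T)^{-1}-1)$. Every $\iota$-invariant element of $\mathbb{Z}_p[[T]]$ can be written uniquely as $g(T+\iota(T))$ with $g \in \mathbb{Z}_p[[S]]$. The $\mathbb{Z}_p$-homomorphism $\Phi:\mathbb{Z}_p[[T]]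 \to \mathbb{Z}_p[[S]]$ is defined by letting $\Phi(h)$ be the unique $g$ with $g(T+\iota(T)) = h + \iota(h)$. For $g \in \mathbb{Z}_p[[S]]\setminus\{0\}$, $\mu_S(g)$ is the largest integer $m$ with $g \in p^{m}\mathbb{Z}_p[[S]]$, and $\lambda_S(g)$ is the largest integer $k$ such that the reduction of $p^{-\mu_S(g)}g$ modulo $p$ lies in $S^{k}\mathbb{F}_p[[S]]$. The quantities $\lambda(h),\mu(h)$ are thus defined for those $h$ with $\Phi(h) \neq 0$, and an event such as $\lambda(h) = 2\lambda'-1$ or $\mu(h)=0$ means the set of $h$ with $\Phi(h)\ne 0$ having the stated property. (These are treated as the Iwasawa invariants $\lambda(X_\infty/X)$, $\mu(X_\infty/X)$ of a hypothetical $\mathbb{Z}_p$-covering $X_\infty/X$ of a bouquet associated with $h$.) *)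

theory Defs
  imports
    "HOL-Probability.Probability_Measure"
    "HOL-Computational_Algebra.Formal_Power_Series"
    "Berlekamp_Zassenhaus.Finite_Field"
begin

section \<open>The p-adic integers\<close>

text \<open>
  The prime is carried by the index type: \<open>p = CARD('p)\<close> with \<open>'p :: prime_card\<close>, and
  \<open>'p mod_ring\<close> is the field with \<open>p\<close> elements. The p-adic integers are the inverse limit of the
  rings of integers modulo \<open>p ^ n\<close>; the compatibility condition already forces every
  entry \<open>x n\<close> to be the canonical representative in \<open>{0..<p ^ n}\<close>.
\<close>

typedef ('p :: prime_card) padic_int =
  "{x :: nat \<Rightarrow> int. \<forall>n. x (Suc n) mod int CARD('p) ^ n = x n}"
  morphisms padic_residue Abs_padic_int
  by (rule exI[of _ "\<lambda>_. 0"]) simp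

setup_lifting type_definition_padic_int

lemma mod_power_Suc_cancel: "a mod int q ^ Suc n mod int q ^ n = a mod int q ^ n"
  by (rule mod_mod_cancel) simp

lemma padic_compat_self:
  assumes "\<forall>n. x (Suc n) mod int q ^ n = x n"
  shows "x n mod int q ^ n = x n"
  by (subst (1 2) assms[rule_format, symmetric]) (rule mod_mod_trivial)

instantiation padic_int :: (prime_card) comm_ring_1
begin

lift_definition zero_padic_int :: "'a padic_int" is "\<lambda>_. 0" by simp

lift_definition one_padic_int :: "'a padic_int" is "\<lambda>n. 1 mod int CARD('a) ^ n"
  by (simp only: mod_power_Suc_cancel simp_thms)

lift_definition plus_padic_int :: "'a padic_int \<Rightarrow> 'a padic_int \<Rightarrow> 'a padic_int"
  is "\<lambda>x y n. (x n + y n) mod int CARD('a) ^ n"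
proof -
  fix x y :: "nat \<Rightarrow> int" and n :: nat
  assume x: "\<And>n. x (Suc n) mod int CARD('a) ^ n = x n"
    and y: "\<And>n. y (Suc n) mod int CARD('a) ^ n = y n"
  show "(x (Suc n) + y (Suc n)) mod int CARD('a) ^ Suc n mod int CARD('a) ^ n = (x n + y n) mod int CARD('a) ^ n"
    unfolding mod_power_Suc_cancel x[symmetric, of n] y[symmetric, of n] mod_add_eq ..
qed

lift_definition minus_padic_int :: "'a padic_int \<Rightarrow> 'a padic_int \<Rightarrow> 'a padic_int"
  is "\<lambda>x y n. (x n - y n) mod int CARD('a) ^ n"
proof -
  fix x y :: "nat \<Rightarrow> int" and n :: nat
  assume x: "\<And>n. x (Suc n) mod int CARD('a) ^ n = x n"
    and y: "\<And>n. y (Suc n) mod int CARD('a) ^ n = y n"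
  show "(x (Suc n) - y (Suc n)) mod int CARD('a) ^ Suc n mod int CARD('a) ^ n = (x n - y n) mod int CARD('a) ^ n"
    unfolding mod_power_Suc_cancel x[symmetric, of n] y[symmetric, of n] mod_diff_eq ..
qed

lift_definition uminus_padic_int :: "'a padic_int \<Rightarrow> 'a padic_int"
  is "\<lambda>x n. (- x n) mod int CARD('a) ^ n"
proof -
  fix x :: "nat \<Rightarrow> int" and n :: nat
  assume x: "\<And>n. x (Suc n) mod int CARD('a) ^ n = x n"
  show "(- x (Suc n)) mod int CARD('a) ^ Suc n mod int CARD('a) ^ n = (- x n) mod int CARD('a) ^ n"
    unfolding mod_power_Suc_cancel x[symmetric, of n] mod_minus_eq ..
qed

lift_definition times_padic_int :: "'a padic_int \<Rightarrow> 'a padic_int \<Rightarrow> 'a padic_int"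
  is "\<lambda>x y n. (x n * y n) mod int CARD('a) ^ n"
proof -
  fix x y :: "nat \<Rightarrow> int" and n :: nat
  assume x: "\<And>n. x (Suc n) mod int CARD('a) ^ n = x n"
    and y: "\<And>n. y (Suc n) mod int CARD('a) ^ n = y n"
  show "(x (Suc n) * y (Suc n)) mod int CARD('a) ^ Suc n mod int CARD('a) ^ n = (x n * y n) mod int CARD('a) ^ n"
    unfolding mod_power_Suc_cancel x[symmetric, of n] y[symmetric, of n] mod_mult_eq ..
qed

instance
proof
  fix a b c :: "'a padic_int"
  show "a + b + c = a + (b + c)"
    by transfer (simp add: fun_eq_iff mod_simps add.assoc)
  show "a + b = b + a"
    by transfer (simp add: fun_eq_iff add.commute)
  show "0 + a = a"
    by transfer (simp add: fun_eq_iff padic_compat_self)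
  show "- a + a = 0"
    by transfer (simp add: fun_eq_iff mod_simps)
  show "a - b = a + - b"
    by transfer (simp add: fun_eq_iff mod_simps)
  show "a * b * c = a * (b * c)"
    by transfer (simp add: fun_eq_iff mod_simps mult.assoc)
  show "a * b = b * a"
    by transfer (simp add: fun_eq_iff mult.commute)
  show "1 * a = a"
    by transfer (simp add: fun_eq_iff mod_simps padic_compat_self)
  show "(a + b) * c = a * c + b * c"
    by transfer (simp add: fun_eq_iff mod_simps distrib_right)
  show "(0 :: 'a padic_int) \<noteq> 1"
  proof transfer
    have "int CARD('a) > 1"
      using prime_card[where 'a = 'a] prime_gt_1_nat by simp
    then have "(\<lambda>_. 0 :: int) 1 \<noteq> (\<lambda>n. 1 mod int CARD('a) ^ n) 1"
      by simp
    then show "(\<lambda>_. 0 :: int) \<noteq> (\<lambda>n. 1 mod int CARD('a) ^ n)"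
      by (rule contrapos_nn) (rule arg_cong[where f = "\<lambda>x. x 1"])
  qed
qed

end

text \<open>The p-adic topology: the residue classes modulo the powers of \<open>p\<close> are a basis.\<close>

instantiation padic_int :: (prime_card) topological_space
begin

definition open_padic_int :: "'a padic_int set \<Rightarrow> bool" where
  "open_padic_int U \<longleftrightarrow>
     (\<forall>x\<in>U. \<exists>n. \<forall>y. padic_residue y n = padic_residue x n \<longrightarrow> y \<in> U)"

instance
proof
  show "open (UNIV :: 'a padic_int set)"
    by (simp add: open_padic_int_def)
next
  fix S T :: "'a padic_int set"
  assume ST: "open S" "open T"
  have compat: "padic_residue x (Suc k) mod int CARD('a) ^ k = padic_residue x k"
    for x :: "'a padic_int" and k
    using padic_residue[of x] by simp
  have mono: "padic_residue y m = padic_residue x m"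
    if "m \<le> n" "padic_residue y n = padic_residue x n" for x y :: "'a padic_int" and m n
    using that
  proof (induction rule: dec_induct)
    case (step k)
    show ?case
      using arg_cong[OF step.prems, of "\<lambda>z. z mod int CARD('a) ^ k"]
      by (intro step.IH) (simp only: compat)
  qed
  show "open (S \<inter> T)"
    unfolding open_padic_int_def
  proof
    fix x assume "x \<in> S \<inter> T"
    then obtain m n
      where m: "\<forall>y. padic_residue y m = padic_residue x m \<longrightarrow> y \<in> S"
        and n: "\<forall>y. padic_residue y n = padic_residue x n \<longrightarrow> y \<in> T"
      using ST unfolding open_padic_int_def by blast
    have "y \<in> S \<inter> T" if "padic_residue y (max m n) = padic_residue x (max m n)" for y
      using m n mono[OF max.cobounded1 that] mono[OF max.cobounded2 that] by blast
    then show "\<exists>k. \<forall>y. padic_residue y k = padic_residue x k \<longrightarrow> y \<in> S \<inter> T"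
      by blast
  qed
next
  fix K :: "'a padic_int set set"
  assume K: "\<forall>S\<in>K. open S"
  show "open (\<Union>K)"
    unfolding open_padic_int_def
  proof
    fix x assume "x \<in> \<Union>K"
    then obtain S where S: "S \<in> K" "x \<in> S"
      by blast
    then obtain n where "\<forall>y. padic_residue y n = padic_residue x n \<longrightarrow> y \<in> S"
      using K unfolding open_padic_int_def by blast
    then show "\<exists>n. \<forall>y. padic_residue y n = padic_residue x n \<longrightarrow> y \<in> \<Union>K"
      using S(1) by blast
  qed
qed

end

definition padic_reduction :: "'p :: prime_card padic_int \<Rightarrow> 'p mod_ring" where
  "padic_reduction x = of_int (padic_residue x 1)"


section \<open>The Iwasawa algebra\<close>

text \<open>
  The completed group ring of \<open>\<Gamma>\<close> over the p-adic integers is identified, as a topological ring,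
  with the power series ring in one variable \<open>T\<close>, the topological generator \<open>\<gamma>\<close> corresponding to
  \<open>1 + T\<close>. Its profinite topology is the topology of coefficientwise p-adic convergence, for which
  the ring is compact. This is not the topology of the instance \<open>fps :: metric_space\<close>, which
  is \<open>T\<close>-adic with discrete coefficients.
\<close>

type_synonym 'p iwasawa = "'p padic_int fps"

definition iwasawa_topology :: "'p :: prime_card iwasawa topology" where
  "iwasawa_topology =
     pullback_topology UNIV fps_nth (product_topology (\<lambda>_. euclidean) UNIV)"

definition aug :: "'p :: prime_card iwasawa \<Rightarrow> 'p padic_int" where
  "aug h = fps_nth h 0"

definition aug_ideal :: "'p :: prime_card iwasawa set" where
  "aug_ideal = {h. aug h = 0}"

text \<open>\<open>fps_right_inverse (1 + fps_X) 1\<close> is the inverse of \<open>1 + T\<close>; the general \<open>inverse\<close> on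
  power series is only available over coefficient types with a division.\<close>

definition iota :: "'p :: prime_card iwasawa \<Rightarrow> 'p iwasawa" where
  "iota f = fps_compose f (fps_right_inverse (1 + fps_X) 1 - 1)"

definition Phi :: "'p :: prime_card iwasawa \<Rightarrow> 'p padic_int fps" where
  "Phi h = (THE g. fps_compose g (fps_X + iota fps_X) = h + iota h)"


section \<open>Iwasawa invariants\<close>

text \<open>The invariants \<open>mu_S\<close> and \<open>lambda_S\<close> are meaningful for nonzero arguments only.\<close>

definition mu_S :: "'p :: prime_card padic_int fps \<Rightarrow> nat" where
  "mu_S g = (GREATEST m. of_nat CARD('p) ^ m dvd g)"

definition fps_reduction :: "'p :: prime_card padic_int fps \<Rightarrow> 'p mod_ring fps" where
  "fps_reduction f = Abs_fps (\<lambda>n. padic_reduction (fps_nth f n))"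

definition p_primitive_part :: "'p :: prime_card padic_int fps \<Rightarrow> 'p padic_int fps" where
  "p_primitive_part g = (THE f. g = of_nat CARD('p) ^ mu_S g * f)"

definition lambda_S :: "'p :: prime_card padic_int fps \<Rightarrow> nat" where
  "lambda_S g = (GREATEST k. fps_X ^ k dvd fps_reduction (p_primitive_part g))"

definition iw_mu :: "'p :: prime_card iwasawa \<Rightarrow> nat" where
  "iw_mu h = mu_S (Phi h)"

definition iw_lambda :: "'p :: prime_card iwasawa \<Rightarrow> int" where
  "iw_lambda h = 2 * int (lambda_S (Phi h)) - 1"


section \<open>Haar probability measure\<close>

text \<open>
  \<open>X\<close> is a topology whose carrier is a compact additive subgroup of the ambient group. For
  metrizable \<open>X\<close>, the only case used, regularity is automatic for finite Borel measures, so a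
  translation invariant Borel probability measure is the Haar probability measure.
\<close>

definition is_haar_probability :: "'a :: ab_group_add topology \<Rightarrow> 'a measure \<Rightarrow> bool" where
  "is_haar_probability X M \<longleftrightarrow>
     prob_space M \<and>
     space M = topspace X \<and>
     sets M = sigma_sets (topspace X) {U. openin X U} \<and>
     (\<forall>a\<in>topspace X. \<forall>A\<in>sets M. emeasure M ((+) a ` A) = emeasure M A)"

end

theory Submission
  imports Defs
begin

text \<open>
  Write \<open>S = T + \<iota>(T) = T\<^sup>2 / (1 + T)\<close>. Division with remainder by \<open>S\<close> shows that every power series
  has the form \<open>h = a(S) + T b(S)\<close> (\<open>invariant_basis_decomposition\<close>). As \<open>\<iota>\<close> fixes \<open>S\<close> and sends \<open>T\<close> to
  \<open>S - T\<close>, this gives \<open>\<Phi>(h) = 2 a + S b\<close> (\<open>Phi_eq\<close>). In particular \<open>\<Phi>\<close> is additive, each coefficient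
  of \<open>\<Phi>(h)\<close> is a finite sum of coefficients of \<open>h\<close>, hence measurable, and \<open>c T S\<^sup>k\<close> is mapped to
  \<open>c S\<^sup>k\<^sup>+\<^sup>1\<close> (\<open>Phi_monomial\<close>), whatever the prime \<open>p\<close>.

  On the augmentation ideal \<open>\<Phi>(h)\<close> has no constant term. Translating by \<open>c T S\<^sup>k\<close> for \<open>0 \<le> c < p\<close>
  permutes the residues modulo \<open>p\<close> of the coefficient of \<open>S\<^sup>k\<^sup>+\<^sup>1\<close> in \<open>\<Phi>(h)\<close> and leaves the other
  coefficients alone. By invariance of the Haar measure, the set of \<open>h\<close> for which \<open>\<Phi>(h)\<close> vanishes
  modulo \<open>p\<close> up to degree \<open>k\<close> therefore has measure \<open>p\<^sup>-\<^sup>k\<close> (\<open>measure_vanishing_set\<close>).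

  Letting \<open>k\<close> tend to infinity, the reduction of \<open>\<Phi>(h)\<close> modulo \<open>p\<close> is almost surely nonzero, that is,
  \<open>\<mu> = 0\<close>. In that case \<open>\<lambda>\<^sub>S(\<Phi>(h))\<close> is the order of vanishing of the reduction, and it equals \<open>l\<close> with
  probability \<open>p\<^sup>-\<^sup>(\<^sup>l\<^sup>-\<^sup>1\<^sup>) - p\<^sup>-\<^sup>l\<close>. The event \<open>\<lambda> = 2 l - 1\<close> also contains series with \<open>\<mu> > 0\<close>. They form a
  subset of a null set, but the Borel measure need not be complete, so the measurability of the
  event has to be shown separately (\<open>lambda_S_eq_iff\<close>).
\<close>

section \<open>Arithmetic of the p-adic integers\<close>

lemma card_gt_1: "1 < int CARD('p :: prime_card)"
  using prime_card[where 'a = 'p] prime_gt_1_nat by simp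

lemma padic_residue_mod_power:
  fixes x :: "'p :: prime_card padic_int"
  assumes "m \<le> n"
  shows "padic_residue x n mod int CARD('p) ^ m = padic_residue x m"
  using assms
proof (induction rule: dec_induct)
  case base
  show ?case
    using padic_residue[of x] by (intro padic_compat_self) simp
next
  case (step k)
  have "padic_residue x (Suc k) mod int CARD('p) ^ m =
      padic_residue x (Suc k) mod int CARD('p) ^ k mod int CARD('p) ^ m"
    using step.hyps by (intro mod_mod_cancel[symmetric] le_imp_power_dvd) simp
  also have "padic_residue x (Suc k) mod int CARD('p) ^ k = padic_residue x k"
    using padic_residue[of x] by simp
  finally show ?case
    using step.IH by simp
qed

lemma padic_residue_of_nat:
  "padic_residue (of_nat k :: 'p :: prime_card padic_int) n = int k mod int CARD('p) ^ n"
  by (induction k)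
    (simp_all add: zero_padic_int.rep_eq plus_padic_int.rep_eq one_padic_int.rep_eq mod_simps)

lemma padic_int_eq_0_iff: "x = 0 \<longleftrightarrow> (\<forall>n. padic_residue x n = 0)"
  by (simp add: padic_residue_inject[symmetric] zero_padic_int.rep_eq fun_eq_iff)

lemma padic_residue_dvd_eq_0_iff:
  fixes x :: "'p :: prime_card padic_int"
  assumes "m \<le> n"
  shows "int CARD('p) ^ m dvd padic_residue x n \<longleftrightarrow> padic_residue x m = 0"
  by (simp add: dvd_eq_mod_eq_0 padic_residue_mod_power[OF assms])

text \<open>
  If \<open>p ^ (m + n)\<close> divides a product of integers, then \<open>p ^ m\<close> divides the first factor or \<open>p ^ n\<close>
  the second one. Applied to residues modulo \<open>p ^ (m + n)\<close>, this excludes zero divisors. Being an integral domain is what makes substitution of power series over the p-adic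
  integers multiplicative and associative.
\<close>

instance padic_int :: (prime_card) idom
proof
  fix x y :: "'a padic_int"
  assume "x \<noteq> 0" "y \<noteq> 0"
  then obtain m n where m: "padic_residue x m \<noteq> 0" and n: "padic_residue y n \<noteq> 0"
    by (auto simp: padic_int_eq_0_iff)
  show "x * y \<noteq> 0"
  proof
    assume "x * y = 0"
    then have "int CARD('a) ^ (m + n) dvd padic_residue x (m + n) * padic_residue y (m + n)"
      by (metis padic_int_eq_0_iff times_padic_int.rep_eq dvd_eq_mod_eq_0)
    moreover have "prime_elem (int CARD('a))"
      using prime_card[where 'a = 'a] by simp
    ultimately obtain a b where ab: "a + b = m + n"
      "int CARD('a) ^ a dvd padic_residue x (m + n)" "int CARD('a) ^ b dvd padic_residue y (m + n)"
      using prime_elem_power_dvd_prod by blast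
    then consider "m \<le> a" | "n \<le> b"
      by linarith
    then show False
    proof cases
      case 1
      then have "int CARD('a) ^ m dvd padic_residue x (m + n)"
        using ab(2) power_le_dvd by blast
      then show False
        using m by (simp add: padic_residue_dvd_eq_0_iff)
    next
      case 2
      then have "int CARD('a) ^ n dvd padic_residue y (m + n)"
        using ab(3) power_le_dvd by blast
      then show False
        using n by (simp add: padic_residue_dvd_eq_0_iff)
    qed
  qed
qed

lemma of_nat_card_neq_0: "(of_nat CARD('p) :: 'p :: prime_card padic_int) \<noteq> 0"
proof
  assume "(of_nat CARD('p) :: 'p padic_int) = 0"
  then have "padic_residue (of_nat CARD('p) :: 'p padic_int) 2 = 0"
    by (simp add: padic_int_eq_0_iff)
  then show False
    using card_gt_1[where 'p = 'p] by (simp add: padic_residue_of_nat power2_eq_square)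
qed

text \<open>
  The quotient of \<open>x\<close> by \<open>p ^ m\<close> is read off the residues modulo \<open>p ^ (n + m)\<close>: dividing such a
  residue by \<open>p ^ m\<close> leaves a residue modulo \<open>p ^ n\<close>.
\<close>

lemma power_card_dvd_padic_iff:
  fixes x :: "'p :: prime_card padic_int"
  shows "of_nat CARD('p) ^ m dvd x \<longleftrightarrow> padic_residue x m = 0"
proof
  assume "of_nat CARD('p) ^ m dvd x"
  then obtain y where "x = of_nat (CARD('p) ^ m) * y"
    by (auto simp: of_nat_power)
  moreover have "padic_residue (of_nat (CARD('p) ^ m) :: 'p padic_int) m = 0"
    using padic_residue_of_nat[of "CARD('p) ^ m" m, where 'p = 'p] by simp
  ultimately show "padic_residue x m = 0"
    by (simp add: times_padic_int.rep_eq)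
next
  let ?P = "int CARD('p)"
  assume x: "padic_residue x m = 0"
  have dvd: "?P ^ m dvd padic_residue x (n + m)" for n
    by (simp add: padic_residue_dvd_eq_0_iff x)
  define y where "y = (\<lambda>n. padic_residue x (n + m) div ?P ^ m)"
  have y: "y n * ?P ^ m = padic_residue x (n + m)" for n
    using dvd by (simp add: y_def)
  have "y (Suc n) mod ?P ^ n = y n" for n
  proof -
    have "(y (Suc n) mod ?P ^ n) * ?P ^ m = (y (Suc n) * ?P ^ m) mod (?P ^ n * ?P ^ m)"
      by (simp only: mod_mult_mult2)
    also have "\<dots> = padic_residue x (Suc n + m) mod ?P ^ (n + m)"
      by (simp only: y power_add)
    also have "\<dots> = y n * ?P ^ m"
      by (subst padic_residue_mod_power) (simp_all add: y)
    finally show ?thesis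
      using card_gt_1[where 'p = 'p] by simp
  qed
  then have rep: "padic_residue (Abs_padic_int y :: 'p padic_int) = y"
    by (intro Abs_padic_int_inverse) simp
  have "x = of_nat (CARD('p) ^ m) * Abs_padic_int y"
  proof (rule padic_residue_inject[THEN iffD1], rule ext)
    fix n
    have "padic_residue (of_nat (CARD('p) ^ m) * Abs_padic_int y :: 'p padic_int) n
        = (int (CARD('p) ^ m) * y n) mod ?P ^ n"
      by (simp only: times_padic_int.rep_eq padic_residue_of_nat rep mod_mult_left_eq)
    also have "\<dots> = (y n * ?P ^ m) mod ?P ^ n"
      by (simp only: of_nat_power mult.commute)
    also have "\<dots> = padic_residue x n"
      by (simp add: y padic_residue_mod_power)
    finally show "padic_residue x n =
        padic_residue (of_nat (CARD('p) ^ m) * Abs_padic_int y :: 'p padic_int) n" ..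
  qed
  then show "of_nat CARD('p) ^ m dvd x"
    by (simp add: of_nat_power)
qed

lemma padic_reduction_eq_0_iff: "padic_reduction x = 0 \<longleftrightarrow> padic_residue x 1 = 0"
proof -
  have "padic_reduction x = 0 \<longleftrightarrow> int CARD('a) dvd padic_residue x 1"
    unfolding padic_reduction_def by transfer (simp add: dvd_eq_mod_eq_0)
  also have "\<dots> \<longleftrightarrow> padic_residue x 1 = 0"
    using padic_residue_dvd_eq_0_iff[of 1 1 x] by simp
  finally show ?thesis .
qed


section \<open>Iwasawa invariants of a power series\<close>

lemma fps_const_dvd_iff: "fps_const (c :: 'a :: comm_ring_1) dvd f \<longleftrightarrow> (\<forall>n. c dvd fps_nth f n)"
proof
  assume "\<forall>n. c dvd fps_nth f n"
  then obtain q where "\<And>n. fps_nth f n = c * q n"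
    unfolding dvd_def by metis
  then have "f = fps_const c * Abs_fps q"
    by (simp add: fps_eq_iff)
  then show "fps_const c dvd f"
    by simp
qed auto

lemma of_nat_power_eq_fps_const:
  "(of_nat k :: 'a :: comm_ring_1 fps) ^ m = fps_const (of_nat k ^ m)"
  by (simp only: fps_of_nat[symmetric] fps_const_power)

lemma power_card_dvd_fps_iff:
  fixes f :: "'p :: prime_card padic_int fps"
  shows "of_nat CARD('p) ^ m dvd f \<longleftrightarrow> (\<forall>n. padic_residue (fps_nth f n) m = 0)"
  by (simp only: of_nat_power_eq_fps_const fps_const_dvd_iff power_card_dvd_padic_iff)

lemma fps_reduction_nth_eq_0_iff:
  "fps_nth (fps_reduction f) n = 0 \<longleftrightarrow> padic_residue (fps_nth f n) 1 = 0"
  by (simp add: fps_reduction_def padic_reduction_eq_0_iff)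

lemma fps_reduction_eq_0_iff:
  fixes f :: "'p :: prime_card padic_int fps"
  shows "fps_reduction f = 0 \<longleftrightarrow> of_nat CARD('p) dvd f"
  using power_card_dvd_fps_iff[of 1 f] by (simp add: fps_eq_iff fps_reduction_nth_eq_0_iff)

lemma Greatest_fps_X_power_dvd:
  fixes f :: "'a :: idom fps"
  assumes "f \<noteq> 0"
  shows "(GREATEST k. fps_X ^ k dvd f) = subdegree f"
proof (rule Greatest_equality)
  show "fps_X ^ subdegree f dvd f"
    by (metis dvd_triv_right subdegree_decompose)
next
  fix k assume "fps_X ^ k dvd f"
  then obtain g where "f = fps_X ^ k * g" ..
  moreover from this assms have "g \<noteq> 0"
    by auto
  ultimately show "k \<le> subdegree f"
    by (simp add: subdegree_mult)
qed

text \<open>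
  The invariants are defined by choice operators; a factorization \<open>g = p\<^sup>m f\<close> with \<open>f\<close> nonzero modulo
  \<open>p\<close> determines them, because multiplication by \<open>p\<close> is injective.
\<close>

lemma iwasawa_invariants_power_mult:
  fixes f :: "'p :: prime_card padic_int fps" and m :: nat
  assumes f: "fps_reduction f \<noteq> 0"
  defines "g \<equiv> of_nat CARD('p) ^ m * f"
  shows "g \<noteq> 0" "mu_S g = m" "lambda_S g = subdegree (fps_reduction f)"
proof -
  let ?P = "of_nat CARD('p) :: 'p padic_int fps"
  have P: "?P \<noteq> 0"
    using of_nat_card_neq_0 by (simp only: fps_of_nat[symmetric] fps_const_eq_0_iff)
  have not_dvd: "\<not> ?P dvd f"
    using f by (simp add: fps_reduction_eq_0_iff)
  then show "g \<noteq> 0"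
    using P by (auto simp: g_def)
  show mu: "mu_S g = m"
    unfolding mu_S_def
  proof (rule Greatest_equality)
    show "?P ^ m dvd g"
      by (simp add: g_def)
  next
    fix k assume k: "?P ^ k dvd g"
    show "k \<le> m"
    proof (rule ccontr)
      assume "\<not> k \<le> m"
      then have "?P ^ Suc m dvd g"
        using k by (intro power_le_dvd[OF k]) simp
      then have "?P ^ m * ?P dvd ?P ^ m * f"
        by (simp add: g_def mult.commute)
      then show False
        using P not_dvd by simp
    qed
  qed
  have "p_primitive_part g = f"
    unfolding p_primitive_part_def mu using P by (intro the_equality) (simp_all add: g_def)
  then show "lambda_S g = subdegree (fps_reduction f)"
    using f by (simp add: lambda_S_def Greatest_fps_X_power_dvd)
qed

text \<open>
  Some power of \<open>p\<close> does not divide a nonzero coefficient, so the exact power of \<open>p\<close> can be split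
  off.
\<close>

lemma exact_power_decomposition:
  fixes g :: "'p :: prime_card padic_int fps"
  assumes "g \<noteq> 0"
  obtains m f where "g = of_nat CARD('p) ^ m * f" "fps_reduction f \<noteq> 0"
proof -
  let ?P = "of_nat CARD('p) :: 'p padic_int fps"
  obtain k where k: "\<not> ?P ^ k dvd g"
    using assms by (auto simp: power_card_dvd_fps_iff fps_eq_iff padic_int_eq_0_iff)
  define m where "m = (LEAST m. \<not> ?P ^ Suc m dvd g)"
  have ex: "\<not> ?P ^ Suc (k - 1) dvd g"
    using k by (cases k) auto
  have "\<not> ?P ^ Suc m dvd g"
    unfolding m_def by (rule LeastI[of _ "k - 1"]) (rule ex)
  moreover have "?P ^ m dvd g"
  proof (cases m)
    case (Suc n)
    then have "n < (LEAST m. \<not> ?P ^ Suc m dvd g)"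
      by (simp add: m_def)
    from not_less_Least[OF this] show ?thesis
      using Suc by simp
  qed simp
  then obtain f where f: "g = ?P ^ m * f" ..
  ultimately have "\<not> ?P dvd f"
    by (auto simp: mult.commute[of ?P])
  then show ?thesis
    using that f by (simp add: fps_reduction_eq_0_iff)
qed

text \<open>
  The locus \<open>\<lambda> = l\<close> in terms of residues of coefficients, \<open>m\<close> being the value of \<open>\<mu>\<close>. In this form
  it is a countable union of countable intersections of cylinders.
\<close>

lemma lambda_S_eq_iff:
  fixes g :: "'p :: prime_card padic_int fps"
  shows "g \<noteq> 0 \<and> lambda_S g = l \<longleftrightarrow>
    (\<exists>m. (\<forall>i. padic_residue (fps_nth g i) m = 0) \<and>
         (\<forall>i<l. padic_residue (fps_nth g i) (Suc m) = 0) \<and>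
         padic_residue (fps_nth g l) (Suc m) \<noteq> 0)"
    (is "_ \<longleftrightarrow> ?rhs")
proof -
  let ?P = "of_nat CARD('p) :: 'p padic_int fps"
  have nth: "fps_nth (fps_reduction f) i = 0 \<longleftrightarrow>
      padic_residue (fps_nth (?P ^ m * f) i) (Suc m) = 0" for f m i
  proof -
    have "fps_nth (?P ^ m * f) i = of_nat CARD('p) ^ m * fps_nth f i"
      by (simp only: of_nat_power_eq_fps_const fps_mult_left_const_nth)
    then have "padic_residue (fps_nth (?P ^ m * f) i) (Suc m) = 0 \<longleftrightarrow>
        of_nat CARD('p) ^ m * of_nat CARD('p) dvd of_nat CARD('p) ^ m * fps_nth f i"
      by (simp add: power_card_dvd_padic_iff[symmetric] mult.commute)
    also have "\<dots> \<longleftrightarrow> of_nat CARD('p) ^ 1 dvd fps_nth f i"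
      by (simp add: of_nat_card_neq_0)
    finally show ?thesis
      by (simp only: fps_reduction_nth_eq_0_iff power_card_dvd_padic_iff)
  qed
  show ?thesis
  proof (rule iffI)
    assume "g \<noteq> 0 \<and> lambda_S g = l"
    then have "g \<noteq> 0" and "l = lambda_S g"
      by auto
    obtain m f where g: "g = ?P ^ m * f" and f: "fps_reduction f \<noteq> 0"
      using exact_power_decomposition[OF \<open>g \<noteq> 0\<close>] .
    have l: "lambda_S g = subdegree (fps_reduction f)"
      using iwasawa_invariants_power_mult(3)[OF f] g by simp
    have red: "padic_residue (fps_nth g i) (Suc m) = 0 \<longleftrightarrow> fps_nth (fps_reduction f) i = 0" for i
      unfolding g by (rule nth[symmetric])
    have "\<forall>i. padic_residue (fps_nth g i) m = 0"
      using power_card_dvd_fps_iff[of m g] g by simp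
    moreover have "\<forall>i<lambda_S g. padic_residue (fps_nth g i) (Suc m) = 0"
      unfolding l red by (blast intro: nth_less_subdegree_zero)
    moreover have "padic_residue (fps_nth g (lambda_S g)) (Suc m) \<noteq> 0"
      unfolding l red by (rule nth_subdegree_nonzero[OF f])
    ultimately show "?rhs"
      unfolding \<open>l = lambda_S g\<close> by blast
  next
    assume ?rhs
    then obtain m where m: "\<forall>i. padic_residue (fps_nth g i) m = 0"
      and less: "\<forall>i<l. padic_residue (fps_nth g i) (Suc m) = 0"
      and l: "padic_residue (fps_nth g l) (Suc m) \<noteq> 0"
      by blast
    obtain f where g: "g = ?P ^ m * f"
      using m power_card_dvd_fps_iff[of m g] by auto
    have red: "padic_residue (fps_nth g i) (Suc m) = 0 \<longleftrightarrow> fps_nth (fps_reduction f) i = 0" for i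
      unfolding g by (rule nth[symmetric])
    have "fps_nth (fps_reduction f) l \<noteq> 0" "\<forall>i<l. fps_nth (fps_reduction f) i = 0"
      using l less unfolding red by blast+
    then have "fps_reduction f \<noteq> 0" "subdegree (fps_reduction f) = l"
      by (auto intro: subdegreeI)
    then show "g \<noteq> 0 \<and> lambda_S g = l"
      using iwasawa_invariants_power_mult(1,3)[of f m] g by simp
  qed
qed


section \<open>Power series in the invariant parameter\<close>

text \<open>
  The series \<open>\<iota>(T) = (1 + T) ^ (-1) - 1\<close> and \<open>S = T + \<iota>(T)\<close>, over any commutative ring.
\<close>

definition involution_var :: "'a :: comm_ring_1 fps" where
  "involution_var = fps_right_inverse (1 + fps_X) 1 - 1"

definition invariant_var :: "'a :: comm_ring_1 fps" where
  "invariant_var = fps_X + involution_var"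

lemma one_plus_X_mult_involution_var: "(1 + fps_X) * (1 + involution_var) = (1 :: 'a :: comm_ring_1 fps)"
  unfolding involution_var_def by (simp add: fps_right_inverse)

lemma involution_var_nth_0 [simp]: "fps_nth involution_var 0 = 0"
  by (simp add: involution_var_def)

lemma one_plus_X_mult_invariant_var: "(1 + fps_X) * invariant_var = (fps_X\<^sup>2 :: 'a :: comm_ring_1 fps)"
proof -
  have "(1 + fps_X) * invariant_var = (1 + fps_X) * (1 + involution_var) + (1 + fps_X) * (fps_X - 1 :: 'a fps)"
    by (simp add: invariant_var_def algebra_simps)
  also have "\<dots> = fps_X\<^sup>2"
    unfolding one_plus_X_mult_involution_var by (simp add: algebra_simps power2_eq_square)
  finally show ?thesis .
qed

lemma invariant_var_nth_0 [simp]: "fps_nth invariant_var 0 = 0"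
  by (simp add: invariant_var_def)

lemma invariant_var_neq_0: "invariant_var \<noteq> (0 :: 'a :: idom fps)"
  using one_plus_X_mult_invariant_var[where 'a = 'a] by auto

lemma X_compose [simp]: "fps_nth f 0 = 0 \<Longrightarrow> fps_X oo f = (f :: 'a :: comm_ring_1 fps)"
  by (auto simp: fps_X_fps_compose fps_eq_iff)

text \<open>Both \<open>1 + T\<close> and its image under \<open>\<iota> \<circ> \<iota>\<close> are inverse to \<open>1 + \<iota>(T)\<close>.\<close>

lemma involution_var_involution: "involution_var oo involution_var = (fps_X :: 'a :: idom fps)"
proof -
  let ?w = "involution_var :: 'a fps"
  have "((1 + fps_X) * (1 + ?w)) oo ?w = 1"
    by (simp add: one_plus_X_mult_involution_var)
  then have "(1 + ?w) * (1 + (?w oo ?w)) = 1"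
    by (simp add: fps_compose_mult_distrib fps_compose_add_distrib)
  then have "(1 + fps_X) * ((1 + ?w) * (1 + (?w oo ?w))) = 1 + fps_X"
    by simp
  then show ?thesis
    by (simp add: mult.assoc[symmetric] one_plus_X_mult_involution_var)
qed

lemma invariant_var_compose_involution:
  "invariant_var oo involution_var = (invariant_var :: 'a :: idom fps)"
  by (simp add: invariant_var_def fps_compose_add_distrib involution_var_involution add.commute)

text \<open>
  Since \<open>S = T\<^sup>2 / (1 + T)\<close>, dropping the two lowest terms of \<open>h\<close> and multiplying by \<open>1 + T\<close> gives
  the quotient of \<open>h\<close> by \<open>S\<close>; the remainder has degree at most 1 in \<open>T\<close>. Iterating gives the two
  coordinates of \<open>h\<close> with respect to the basis \<open>1, T\<close> over the power series in \<open>S\<close>.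
\<close>

definition quotient_by_invariant :: "'a :: comm_ring_1 fps \<Rightarrow> 'a fps" where
  "quotient_by_invariant h = (1 + fps_X) * fps_shift 2 h"

definition constant_part :: "'a :: comm_ring_1 fps \<Rightarrow> 'a fps" where
  "constant_part h = Abs_fps (\<lambda>n. fps_nth ((quotient_by_invariant ^^ n) h) 0)"

definition linear_part :: "'a :: comm_ring_1 fps \<Rightarrow> 'a fps" where
  "linear_part h = Abs_fps (\<lambda>n. fps_nth ((quotient_by_invariant ^^ n) h) 1)"

lemma quotient_by_invariant_nth:
  "fps_nth (quotient_by_invariant h) j =
     fps_nth h (j + 2) + (if j = 0 then 0 else fps_nth h (j + 1))"
  by (cases j) (simp_all add: quotient_by_invariant_def distrib_right)

lemma quotient_by_invariant_eq:
  "h = fps_const (fps_nth h 0) + fps_const (fps_nth h 1) * fps_X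
     + invariant_var * quotient_by_invariant h"
proof -
  have "invariant_var * quotient_by_invariant h = ((1 + fps_X) * invariant_var) * fps_shift 2 h"
    by (simp only: quotient_by_invariant_def ac_simps)
  then have q: "invariant_var * quotient_by_invariant h = fps_X\<^sup>2 * fps_shift 2 h"
    by (simp only: one_plus_X_mult_invariant_var)
  show ?thesis
    unfolding q
  proof (rule fps_ext)
    fix n
    show "fps_nth h n = fps_nth (fps_const (fps_nth h 0) + fps_const (fps_nth h 1) * fps_X
        + fps_X\<^sup>2 * fps_shift 2 h) n"
    proof (cases "n < 2")
      case True
      then show ?thesis
        by (auto simp: fps_X_power_mult_nth fps_X_nth less_2_cases_iff)
    next
      case False
      then show ?thesis
        by (simp add: fps_X_power_mult_nth fps_X_nth le_add_diff_inverse2 del: add_2_eq_Suc')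
    qed
  qed
qed

lemma constant_part_rec:
  "constant_part h = fps_const (fps_nth h 0) + fps_X * constant_part (quotient_by_invariant h)"
proof (rule fps_ext)
  fix n
  show "fps_nth (constant_part h) n =
      fps_nth (fps_const (fps_nth h 0) + fps_X * constant_part (quotient_by_invariant h)) n"
    by (cases n) (simp_all add: constant_part_def funpow_Suc_right del: funpow.simps(2))
qed

lemma linear_part_rec:
  "linear_part h = fps_const (fps_nth h 1) + fps_X * linear_part (quotient_by_invariant h)"
proof (rule fps_ext)
  fix n
  show "fps_nth (linear_part h) n =
      fps_nth (fps_const (fps_nth h 1) + fps_X * linear_part (quotient_by_invariant h)) n"
    by (cases n) (simp_all add: linear_part_def funpow_Suc_right del: funpow.simps(2))
qed

text \<open>
  The error term of the decomposition is \<open>S\<close> times the error term for the quotient of \<open>h\<close> by \<open>S\<close>;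
  as \<open>S\<close> has no constant term, its coefficients vanish one after the other.
\<close>

lemma invariant_basis_decomposition:
  fixes h :: "'a :: idom fps"
  shows "h = (constant_part h oo invariant_var) + fps_X * (linear_part h oo invariant_var)"
proof -
  define E where "E h = h - (constant_part h oo invariant_var)
    - fps_X * (linear_part h oo invariant_var)" for h :: "'a fps"
  have rec: "E h = invariant_var * E (quotient_by_invariant h)" for h
  proof -
    let ?q = "quotient_by_invariant h"
    have c: "constant_part h oo invariant_var =
        fps_const (fps_nth h 0) + invariant_var * (constant_part ?q oo invariant_var)"
      by (subst constant_part_rec) (simp add: fps_compose_add_distrib fps_compose_mult_distrib)
    have l: "linear_part h oo invariant_var =
        fps_const (fps_nth h 1) + invariant_var * (linear_part ?q oo invariant_var)"
      by (subst linear_part_rec) (simp add: fps_compose_add_distrib fps_compose_mult_distrib)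
    have "E h = fps_const (fps_nth h 0) + fps_const (fps_nth h 1) * fps_X + invariant_var * ?q
      - (constant_part h oo invariant_var) - fps_X * (linear_part h oo invariant_var)"
      unfolding E_def by (subst (1) quotient_by_invariant_eq) simp
    then show ?thesis
      unfolding c l E_def by (simp add: algebra_simps)
  qed
  have "fps_nth (E h) n = 0" for n h
  proof (induction n arbitrary: h rule: less_induct)
    case (less n)
    have "fps_nth (invariant_var :: 'a fps) i * fps_nth (E (quotient_by_invariant h)) (n - i) = 0"
      if "i \<le> n" for i
      using that less.IH by (cases "i = 0") auto
    then show ?case
      by (subst rec) (auto simp: fps_mult_nth intro!: sum.neutral)
  qed
  then have "E h = 0"
    by (simp add: fps_eq_iff)
  then show ?thesis
    by (simp add: E_def algebra_simps)
qed


section \<open>The map to power series in the invariant parameter\<close>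

lemma iota_eq: "iota f = f oo involution_var"
  by (simp add: iota_def involution_var_def)

lemma iota_X: "iota fps_X = involution_var"
  by (simp add: iota_eq)

lemma iota_add: "iota (f + g) = iota f + iota g"
  by (simp add: iota_eq fps_compose_add_distrib)

lemma iota_mult: "iota (f * g) = iota f * iota g"
  by (simp add: iota_eq fps_compose_mult_distrib)

lemma iota_compose_invariant_var: "iota (f oo invariant_var) = f oo invariant_var"
  by (simp add: iota_eq fps_compose_assoc[symmetric] invariant_var_compose_involution)

text \<open>
  Substituting the nonzero series \<open>S\<close> without constant term is injective, which makes the
  description in the definition of \<open>\<Phi>\<close> unique.
\<close>

lemma Phi_eqI:
  assumes "g oo invariant_var = h + iota h"
  shows "Phi h = g"
  unfolding Phi_def
proof (rule the_equality)
  show "g oo (fps_X + iota fps_X) = h + iota h"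
    using assms by (simp add: iota_X invariant_var_def)
next
  fix g' assume "g' oo (fps_X + iota fps_X) = h + iota h"
  then have "(g' - g) oo invariant_var = 0"
    using assms by (simp add: iota_X invariant_var_def[symmetric] fps_compose_sub_distrib)
  then show "g' = g"
    by (simp add: fps_compose_eq_0_iff invariant_var_neq_0)
qed

text \<open>
  Applying \<open>\<iota>\<close> to \<open>h = a(S) + T b(S)\<close> only changes \<open>T\<close>, and \<open>T + \<iota>(T) = S\<close>.
\<close>

lemma add_iota_eq:
  "h + iota h = (2 * constant_part h + fps_X * linear_part h) oo invariant_var"
proof -
  define a b where "a = constant_part h oo invariant_var" and "b = linear_part h oo invariant_var"
  have h: "h = a + fps_X * b"
    unfolding a_def b_def by (rule invariant_basis_decomposition)
  have "iota a = a" "iota b = b"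
    by (simp_all add: a_def b_def iota_compose_invariant_var)
  then have "h + iota h = (a + fps_X * b) + (a + involution_var * b)"
    unfolding h by (simp add: iota_add iota_mult iota_X)
  also have "\<dots> = 2 * a + invariant_var * b"
    by (simp add: invariant_var_def algebra_simps)
  also have "\<dots> = (2 * constant_part h + fps_X * linear_part h) oo invariant_var"
    unfolding a_def b_def mult_2 fps_compose_add_distrib
    by (simp only: fps_compose_mult_distrib invariant_var_nth_0 X_compose)
  finally show ?thesis .
qed

lemma Phi_eq: "Phi h = 2 * constant_part h + fps_X * linear_part h"
  by (rule Phi_eqI) (rule add_iota_eq[symmetric])

lemma Phi_compose: "Phi h oo invariant_var = h + iota h"
  by (simp add: Phi_eq add_iota_eq)

lemma Phi_add: "Phi (f + h) = Phi f + Phi h"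
  by (rule Phi_eqI) (simp add: Phi_compose fps_compose_add_distrib iota_add)

lemma Phi_nth_0: "h \<in> aug_ideal \<Longrightarrow> fps_nth (Phi h) 0 = 0"
  by (simp add: Phi_eq constant_part_def aug_ideal_def aug_def)

text \<open>
  These preimages of the monomials show that \<open>\<Phi>\<close> maps the augmentation ideal onto the multiples
  of \<open>S\<close>, also for \<open>p = 2\<close>, although invariant elements are merely doubled.
\<close>

lemma Phi_monomial:
  "Phi (fps_const c * fps_X * invariant_var ^ k) = fps_const c * fps_X ^ Suc k"
proof (rule Phi_eqI)
  have "iota (invariant_var ^ k) = (invariant_var ^ k :: 'a iwasawa)"
    using iota_compose_invariant_var[of "fps_X ^ k"] by (simp add: fps_compose_power[symmetric])
  then show "fps_const c * fps_X ^ Suc k oo invariant_var =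
      fps_const c * fps_X * invariant_var ^ k + iota (fps_const c * fps_X * invariant_var ^ k)"
    by (simp add: iota_mult iota_X fps_compose_mult_distrib fps_compose_power[symmetric]
        iota_eq[of "fps_const c"] invariant_var_def algebra_simps)
qed


section \<open>Measurability\<close>

text \<open>
  This is Borel measurability for the p-adic topology, tested on the countably many basic open
  sets. The residues take values in a countable discrete space, so that sums can be treated
  without a product sigma-algebra.
\<close>

definition residue_measurable :: "'b measure \<Rightarrow> ('b \<Rightarrow> 'p :: prime_card padic_int) \<Rightarrow> bool" where
  "residue_measurable M F \<longleftrightarrow> (\<forall>m. (\<lambda>h. padic_residue (F h) m) \<in> measurable M (count_space UNIV))"

lemma residue_measurable_0: "residue_measurable M (\<lambda>_. 0)"
  by (simp add: residue_measurable_def)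

lemma residue_measurable_add:
  fixes F :: "'b \<Rightarrow> 'p :: prime_card padic_int"
  assumes "residue_measurable M F" "residue_measurable M G"
  shows "residue_measurable M (\<lambda>h. F h + G h)"
  unfolding residue_measurable_def
proof
  fix m
  have F: "(\<lambda>h. padic_residue (F h) m) \<in> measurable M (count_space UNIV)"
    and G: "(\<lambda>h. padic_residue (G h) m) \<in> measurable M (count_space UNIV)"
    using assms by (simp_all add: residue_measurable_def)
  have "(\<lambda>h. (padic_residue (F h) m + i) mod int CARD('p) ^ m) \<in> measurable M (count_space UNIV)" for i
    by (rule measurable_compose[OF F]) simp
  from measurable_compose_countable[OF this G]
  show "(\<lambda>h. padic_residue (F h + G h) m) \<in> measurable M (count_space UNIV)"
    by (simp add: plus_padic_int.rep_eq)
qed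

lemma residue_measurable_coefficient:
  fixes M :: "'p :: prime_card iwasawa measure"
  assumes "is_haar_probability (subtopology iwasawa_topology aug_ideal) M"
  shows "residue_measurable M (\<lambda>h. fps_nth h j)"
  unfolding residue_measurable_def
proof
  fix m
  have top: "topspace (iwasawa_topology :: 'p iwasawa topology) = UNIV"
    by (simp add: iwasawa_topology_def topspace_pullback_topology)
  have space: "space M = aug_ideal"
    and sets: "sets M = sigma_sets aug_ideal {U. openin (subtopology iwasawa_topology aug_ideal) U}"
    using assms by (simp_all add: is_haar_probability_def top)
  have "(\<lambda>h. padic_residue (fps_nth h j) m) -` {c} \<inter> space M \<in> sets M" for c
  proof -
    let ?V = "{x :: 'p padic_int. padic_residue x m = c}"
    have "open ?V"
      by (auto simp: open_padic_int_def)
    then have "openin (product_topology (\<lambda>_. euclidean) UNIV) {x. x j \<in> ?V}"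
      using openin_continuous_map_preimage[OF
          continuous_map_product_projection[of j UNIV "\<lambda>_. euclidean :: 'p padic_int topology"], of ?V]
      by simp
    then have "openin iwasawa_topology (fps_nth -` {x. x j \<in> ?V} \<inter> UNIV)"
      unfolding iwasawa_topology_def openin_pullback_topology by blast
    then have "openin (subtopology iwasawa_topology aug_ideal) (fps_nth -` {x. x j \<in> ?V} \<inter> aug_ideal)"
      unfolding openin_subtopology by auto
    then show ?thesis
      unfolding sets space by (intro sigma_sets.Basic) (simp add: vimage_def)
  qed
  then show "(\<lambda>h. padic_residue (fps_nth h j) m) \<in> measurable M (count_space UNIV)"
    by (simp add: measurable_count_space_eq2_countable)
qed

text \<open>
  Each coefficient of \<open>\<Phi>(h)\<close> is obtained from those of \<open>h\<close> by finitely many additions.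
\<close>

lemma residue_measurable_Phi:
  fixes M :: "'p :: prime_card iwasawa measure"
  assumes "is_haar_probability (subtopology iwasawa_topology aug_ideal) M"
  shows "residue_measurable M (\<lambda>h. fps_nth (Phi h) i)"
proof -
  have iter: "residue_measurable M (\<lambda>h. fps_nth ((quotient_by_invariant ^^ n) h) j)" for n j
  proof (induction n arbitrary: j)
    case 0
    show ?case
      using residue_measurable_coefficient[OF assms] by simp
  next
    case (Suc n)
    show ?case
      using Suc.IH
      by (cases "j = 0") (simp_all add: quotient_by_invariant_nth residue_measurable_add)
  qed
  have "fps_nth (Phi h) i = fps_nth (constant_part h) i + fps_nth (constant_part h) i
      + (if i = 0 then 0 else fps_nth (linear_part h) (i - 1))" for h :: "'p iwasawa"
    unfolding Phi_eq mult_2 fps_add_nth by simp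
  moreover have "residue_measurable M (\<lambda>h. fps_nth (constant_part h) i)"
    by (simp add: constant_part_def iter)
  moreover have "residue_measurable M (\<lambda>h. if i = 0 then 0 else fps_nth (linear_part h) (i - 1))"
    by (cases "i = 0") (simp_all add: linear_part_def iter residue_measurable_0)
  ultimately show ?thesis
    by (simp only: residue_measurable_add)
qed


section \<open>The distribution of the residues of the coefficients\<close>

definition vanishing_set :: "nat \<Rightarrow> 'p :: prime_card iwasawa set" where
  "vanishing_set k = {h \<in> aug_ideal. \<forall>i\<le>k. padic_residue (fps_nth (Phi h) i) 1 = 0}"

text \<open>
  By additivity of \<open>\<Phi>\<close>, adding \<open>c T S\<^sup>k\<close> to \<open>h\<close> shifts the coefficient of \<open>S ^ Suc k\<close> in \<open>\<Phi>(h)\<close> by \<open>c\<close>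
  and changes no other one.
\<close>

lemma translate_vanishing_set:
  fixes c :: "'p :: prime_card padic_int" and k :: nat
  defines "t \<equiv> fps_const c * fps_X * invariant_var ^ k"
  shows "(+) t ` vanishing_set (Suc k) =
    {h \<in> vanishing_set k. padic_residue (fps_nth (Phi h) (Suc k)) 1 = padic_residue c 1}"
proof -
  have t: "t \<in> aug_ideal"
    by (simp add: t_def aug_ideal_def aug_def)
  have Phi: "fps_nth (Phi (t + f)) i = (if i = Suc k then c else 0) + fps_nth (Phi f) i" for f i
    by (simp add: Phi_add t_def Phi_monomial fps_X_power_nth del: power_Suc)
  have mod: "padic_residue x 1 mod int CARD('p) = padic_residue x 1" for x :: "'p padic_int"
    using padic_residue_mod_power[of 1 1 x] by simp
  show ?thesis
  proof (intro equalityI subsetI)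
    fix h assume "h \<in> (+) t ` vanishing_set (Suc k)"
    then obtain f where f: "f \<in> vanishing_set (Suc k)" and h: "h = t + f"
      by blast
    show "h \<in> {h \<in> vanishing_set k. padic_residue (fps_nth (Phi h) (Suc k)) 1 = padic_residue c 1}"
      using f t mod[of c] unfolding h
      by (simp add: vanishing_set_def Phi plus_padic_int.rep_eq aug_ideal_def aug_def)
  next
    fix h :: "'p iwasawa"
    assume h: "h \<in> {h \<in> vanishing_set k. padic_residue (fps_nth (Phi h) (Suc k)) 1 = padic_residue c 1}"
    define f where "f = h - t"
    have "fps_nth (Phi f) i = fps_nth (Phi h) i - (if i = Suc k then c else 0)" for i
      using Phi[of f i] by (simp add: f_def)
    then have "f \<in> vanishing_set (Suc k)"
      using h t
      by (auto simp: vanishing_set_def minus_padic_int.rep_eq aug_ideal_def aug_def f_def le_Suc_eq)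
    then show "h \<in> (+) t ` vanishing_set (Suc k)"
      by (intro image_eqI[of _ _ f]) (simp_all add: f_def)
  qed
qed

context
  fixes M :: "'p :: prime_card iwasawa measure"
  assumes haar: "is_haar_probability (subtopology iwasawa_topology aug_ideal) M"
begin

lemma haar_prob_space: "prob_space M"
  using haar by (simp add: is_haar_probability_def)

lemma haar_space: "space M = aug_ideal"
  using haar by (simp add: is_haar_probability_def iwasawa_topology_def topspace_pullback_topology)

lemma haar_translate:
  assumes "t \<in> aug_ideal" "A \<in> sets M"
  shows "measure M ((+) t ` A) = measure M A"
  using haar assms by (simp add: is_haar_probability_def measure_def haar_space[symmetric])

lemma residue_Phi_measurable [measurable]:
  "(\<lambda>h. padic_residue (fps_nth (Phi h) i) m) \<in> measurable M (count_space UNIV)"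
  using residue_measurable_Phi[OF haar] by (simp add: residue_measurable_def)

lemma vanishing_set_eq:
  "vanishing_set k = {h \<in> space M. \<forall>i\<le>k. padic_residue (fps_nth (Phi h) i) 1 = 0}"
  by (simp add: vanishing_set_def haar_space)

lemma vanishing_set_measurable [measurable]: "vanishing_set k \<in> sets M"
  unfolding vanishing_set_eq by measurable

text \<open>
  The residue of the coefficient of \<open>S ^ Suc k\<close> splits \<open>vanishing_set k\<close> into \<open>p\<close> pieces, which
  are translates of one another and hence equally likely.
\<close>

lemma measure_vanishing_set_Suc:
  "measure M (vanishing_set k) = real CARD('p) * measure M (vanishing_set (Suc k))"
proof -
  interpret prob_space M
    by (rule haar_prob_space)
  define piece where
    "piece c = {h :: 'p iwasawa. h \<in> vanishing_set k \<and>
       padic_residue (fps_nth (Phi h) (Suc k)) 1 = int c}" for c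
  have piece: "piece c \<in> sets M \<and> measure M (piece c) = measure M (vanishing_set (Suc k))"
    if "c < CARD('p)" for c
  proof
    show "piece c \<in> sets M"
      unfolding piece_def vanishing_set_eq by measurable
    define t :: "'p iwasawa" where "t = fps_const (of_nat c) * fps_X * invariant_var ^ k"
    have "t \<in> aug_ideal"
      by (simp add: t_def aug_ideal_def aug_def)
    moreover have "piece c = (+) t ` vanishing_set (Suc k)"
      using that by (simp add: piece_def t_def translate_vanishing_set padic_residue_of_nat)
    ultimately show "measure M (piece c) = measure M (vanishing_set (Suc k))"
      by (simp add: haar_translate)
  qed
  have "(vanishing_set k :: 'p iwasawa set) \<subseteq> (\<Union>c<CARD('p). piece c)"
  proof
    fix h :: "'p iwasawa" assume h: "h \<in> vanishing_set k"
    let ?r = "padic_residue (fps_nth (Phi h) (Suc k)) 1"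
    have "?r = ?r mod int CARD('p)"
      using padic_residue_mod_power[of 1 1 "fps_nth (Phi h) (Suc k)"] by simp
    then have "0 \<le> ?r" "?r < int CARD('p)"
      using card_gt_1[where 'p = 'p] pos_mod_bound[of "int CARD('p)" ?r]
        pos_mod_sign[of "int CARD('p)" ?r] by linarith+
    then have "h \<in> piece (nat ?r)" "nat ?r < CARD('p)"
      using h by (auto simp: piece_def)
    then show "h \<in> (\<Union>c<CARD('p). piece c)"
      by blast
  qed
  then have "(vanishing_set k :: 'p iwasawa set) = (\<Union>c<CARD('p). piece c)"
    by (auto simp: piece_def)
  also have "measure M \<dots> = (\<Sum>c<CARD('p). measure M (piece c))"
    using piece by (intro finite_measure_finite_Union) (auto simp: disjoint_family_on_def piece_def)
  also have "\<dots> = real CARD('p) * measure M (vanishing_set (Suc k))"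
    using piece by simp
  finally show ?thesis .
qed

lemma measure_vanishing_set: "measure M (vanishing_set k) = 1 / real CARD('p) ^ k"
proof (induction k)
  case 0
  have "(vanishing_set 0 :: 'p iwasawa set) = space M"
    by (auto simp: vanishing_set_def haar_space Phi_nth_0 zero_padic_int.rep_eq)
  then show ?case
    by (simp add: prob_space.prob_space[OF haar_prob_space])
next
  case (Suc k)
  then show ?case
    using measure_vanishing_set_Suc[of k] by (simp add: field_simps)
qed

text \<open>
  The exceptional set lies in \<open>vanishing_set k\<close> for every \<open>k\<close>.
\<close>

lemma AE_fps_reduction_Phi_neq_0: "AE h in M. fps_reduction (Phi h) \<noteq> 0"
proof (rule AE_I)
  interpret prob_space M
    by (rule haar_prob_space)
  let ?N = "{h \<in> space M. fps_reduction (Phi h) = 0}"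
  have N: "?N = {h \<in> space M. \<forall>i. padic_residue (fps_nth (Phi h) i) 1 = 0}"
    by (simp add: fps_eq_iff fps_reduction_nth_eq_0_iff)
  show "?N \<in> sets M"
    unfolding N by measurable
  have le: "measure M ?N \<le> 1 / real CARD('p) ^ k" for k
    unfolding measure_vanishing_set[symmetric]
    by (rule finite_measure_mono) (auto simp: N vanishing_set_eq)
  have "(\<lambda>k. (1 / real CARD('p)) ^ k) \<longlonglongrightarrow> 0"
    using card_gt_1[where 'p = 'p] by (intro LIMSEQ_power_zero) simp
  then have "measure M ?N \<le> 0"
    using le by (intro LIMSEQ_le_const) (auto simp: power_divide)
  then show "emeasure M ?N = 0"
    by (simp add: emeasure_eq_measure measure_le_0_iff)
  show "{h \<in> space M. \<not> fps_reduction (Phi h) \<noteq> 0} \<subseteq> ?N"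
    by auto
qed

lemma lambda_locus_measurable: "{h \<in> space M. Phi h \<noteq> 0 \<and> lambda_S (Phi h) = l} \<in> sets M"
  unfolding lambda_S_eq_iff by measurable

text \<open>
  Where the reduction of \<open>\<Phi>(h)\<close> is nonzero, the invariant is its order of vanishing, and the locus
  is the difference of two consecutive vanishing sets.
\<close>

lemma measure_lambda_locus:
  assumes "l \<ge> 1"
  shows "measure M {h \<in> space M. Phi h \<noteq> 0 \<and> lambda_S (Phi h) = l} =
    1 / real CARD('p) ^ (l - 1) * (1 - 1 / real CARD('p))"
proof -
  interpret prob_space M
    by (rule haar_prob_space)
  obtain k where l: "l = Suc k"
    using assms by (cases l) auto
  have locus: "Phi h \<noteq> 0 \<and> lambda_S (Phi h) = Suc k \<longleftrightarrow> h \<in> vanishing_set k - vanishing_set (Suc k)"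
    if h: "h \<in> space M" and red: "fps_reduction (Phi h) \<noteq> 0" for h
  proof -
    have *: "subdegree f = Suc k \<longleftrightarrow> (\<forall>i\<le>k. fps_nth f i = 0) \<and> fps_nth f (Suc k) \<noteq> 0"
      if "f \<noteq> 0" for f :: "'p mod_ring fps"
      using nth_subdegree_nonzero[OF that] nth_less_subdegree_zero[of _ f] subdegreeI[of f "Suc k"]
      by (metis less_Suc_eq_le)
    have "Phi h \<noteq> 0" "lambda_S (Phi h) = subdegree (fps_reduction (Phi h))"
      using iwasawa_invariants_power_mult[OF red, of 0] by simp_all
    then show ?thesis
      using h *[OF red] by (auto simp: vanishing_set_eq fps_reduction_nth_eq_0_iff le_Suc_eq)
  qed
  have "measure M {h \<in> space M. Phi h \<noteq> 0 \<and> lambda_S (Phi h) = l} =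
      measure M (vanishing_set k - vanishing_set (Suc k))"
    unfolding l
  proof (rule finite_measure_eq_AE)
    show "AE h in M. h \<in> {h \<in> space M. Phi h \<noteq> 0 \<and> lambda_S (Phi h) = Suc k} \<longleftrightarrow>
        h \<in> vanishing_set k - vanishing_set (Suc k)"
      using AE_fps_reduction_Phi_neq_0 AE_space by eventually_elim (simp add: locus)
  qed (use lambda_locus_measurable in auto)
  also have "\<dots> = measure M (vanishing_set k) - measure M (vanishing_set (Suc k))"
    by (rule finite_measure_Diff[OF vanishing_set_measurable vanishing_set_measurable])
      (auto simp: vanishing_set_def)
  also have "\<dots> = 1 / real CARD('p) ^ k * (1 - 1 / real CARD('p))"
    by (simp add: measure_vanishing_set field_simps)
  finally show ?thesis
    by (simp add: l)
qed

end

theorem proposition5p1: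
  fixes M :: "'p :: prime_card iwasawa measure"
  assumes "is_haar_probability (subtopology iwasawa_topology aug_ideal) M"
  shows "(AE h in M. Phi h \<noteq> 0 \<and> iw_mu h = 0) \<and>
         (\<forall>l::nat. l \<ge> 1 \<longrightarrow>
            measure M {h \<in> space M. Phi h \<noteq> 0 \<and> iw_lambda h = 2 * int l - 1}
              = 1 / real CARD('p) ^ (l - 1) * (1 - 1 / real CARD('p)))"
proof
  show "AE h in M. Phi h \<noteq> 0 \<and> iw_mu h = 0"
    using AE_fps_reduction_Phi_neq_0[OF assms]
  proof eventually_elim
    case (elim h)
    then show ?case
      using iwasawa_invariants_power_mult(1,2)[OF elim, of 0] by (simp add: iw_mu_def)
  qed
  have "iw_lambda h = 2 * int l - 1 \<longleftrightarrow> lambda_S (Phi h) = l" for h :: "'p iwasawa" and l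
    by (auto simp: iw_lambda_def)
  then show "\<forall>l::nat. l \<ge> 1 \<longrightarrow>
            measure M {h \<in> space M. Phi h \<noteq> 0 \<and> iw_lambda h = 2 * int l - 1}
              = 1 / real CARD('p) ^ (l - 1) * (1 - 1 / real CARD('p))"
    using measure_lambda_locus[OF assms] by simp
qed

end
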